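(* Let $\mathbb{K}$ be an algebraically closed field, $q\in\mathbb{K}$ a primitive $l$-th root of unity with $l\ge3$, and $\underline{\mu}=(\mu_1,\mu_2,\mu_3,\mu_4)\in(\mathbb{K}^* )^4$. Let $l_1$ be the multiplicative order of $q^2$. Then the module $M_1(\underline{\mu})$ is a simple $\mathcal{A}$-module of dimension $l_1l$ over $\mathbb{K}$.
   Context: The quantum spatial ageing algebra $\mathcal{A}$ is the $\mathbb{K}$-algebra generated by $E,K,K^{-1},X,Y$ ($K^{-1}$ the inverse of $K$) with relations $$EK=q^{-2}KE,\quad XK=q^{-1}KX,\quad YK=qKY,\quad EX=qXE,\quad EY=X+q^{-1}YE,\quad XY=qYX.$$ Modules are right modules. We have $l_1=l$ if $l$ is odd and $l_1=l/2$ if $l$ is even. $M_1(\underline{\mu})$ has $\mathbb{K}$-basis $\{e(a_1,a_2): 0\le a_1\le l_1-1,\ 0\le a_2\le l-1\}$; in the first argument addition is modulo $l_1$, in the second modulo $l$. The action is: $e(a_1,a_2)X=\mu_1q^{a_1+a_2}e(a_1,a_2)$, $e(a_1,a_2)K^{\pm1}=\mu_4^{\pm1}e(a_1,a_2\pm1)$. If $l$ is odd: $e(a_1,a_2)E=\mu_3q^{2a_2}e(a_1+1,a_2)$ and $e(a_1,a_2)Y=\mu_3^{-1}q^{-(a_1+a_2)}\frac{q\mu_2-q^{2a_1+1}\mu_1}{1-q^2}e(a_1-1,a_2)$. If $l$ is even: $e(a_1,a_2)E=\mu_3q^{2a_2}e(a_1+1,a_2)$ for $a_1\neq\frac l2-1$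 and $e(\frac l2-1,a_2)E=\mu_3q^{2a_2}e(0,\frac l2+a_2)$; $e(a_1,a_2)Y=\mu_3^{-1}q^{-(a_1+a_2)}\frac{q\mu_2-q^{2a_1+1}\mu_1}{1-q^2}e(a_1-1,a_2)$ for $a_1\ne0$ and $e(0,a_2)Y=\mu_3^{-1}q^{-a_2}\frac{q(\mu_2-\mu_1)}{1-q^2}e(\frac l2-1,\frac l2+a_2)$. *)

theory Defs
  imports
    "HOL-Library.Poly_Mapping"
    "HOL-Computational_Algebra.Polynomial"
    "HOL-Algebra.QuotRing"
    "HOL-Algebra.Module"
begin

section \<open>Multiplicative order and primitive roots of unity\<close>

definition mult_order :: "'a::monoid_mult \<Rightarrow> nat"
  where "mult_order x = (LEAST n. 0 < n \<and> x ^ n = 1)"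

definition primitive_root_of_unity :: "nat \<Rightarrow> 'a::monoid_mult \<Rightarrow> bool"
  where "primitive_root_of_unity l q \<longleftrightarrow>
    0 < l \<and> q ^ l = 1 \<and> (\<forall>k. 0 < k \<and> k < l \<longrightarrow> q ^ k \<noteq> 1)"


section \<open>Free vector spaces\<close>

definition pm_scale :: "'k::field \<Rightarrow> ('i \<Rightarrow>\<^sub>0 'k) \<Rightarrow> ('i \<Rightarrow>\<^sub>0 'k)"
  where "pm_scale c v = Poly_Mapping.map ((*) c) v"

lemma lookup_pm_scale: "Poly_Mapping.lookup (pm_scale c v) i = c * Poly_Mapping.lookup v i"
  by (simp add: pm_scale_def map.rep_eq when_def)

lemma vector_space_pm_scale:
  "vector_space (pm_scale :: 'k::field \<Rightarrow> ('i \<Rightarrow>\<^sub>0 'k) \<Rightarrow> _)"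
  by unfold_locales
    (auto intro!: poly_mapping_eqI simp: lookup_pm_scale Poly_Mapping.lookup_add algebra_simps)

definition lin_ext ::
    "('i \<Rightarrow> ('j \<Rightarrow>\<^sub>0 'k)) \<Rightarrow> ('i \<Rightarrow>\<^sub>0 'k) \<Rightarrow> ('j \<Rightarrow>\<^sub>0 'k::field)"
  where "lin_ext \<phi> v = (\<Sum>i\<in>Poly_Mapping.keys v. pm_scale (Poly_Mapping.lookup v i) (\<phi> i))"


section \<open>Free associative algebras\<close>

datatype 'g word = Word (letters: "'g list")

instantiation word :: (type) monoid_add
begin

definition zero_word :: "'a word" where "zero_word = Word []"

definition plus_word :: "'a word \<Rightarrow> 'a word \<Rightarrow> 'a word"
  where "plus_word u v = Word (letters u @ letters v)"

instance
  by standard (auto simp: zero_word_def plus_word_def)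

end

text \<open>
  Since addition of words is concatenation, the convolution product makes
  \<^typ>\<open>'g word \<Rightarrow>\<^sub>0 'k\<close> the algebra of noncommutative polynomials in \<^typ>\<open>'g\<close>.
\<close>

type_synonym ('g, 'k) free_alg = "'g word \<Rightarrow>\<^sub>0 'k"

definition free_alg_ring :: "('g, 'k::field) free_alg ring"
  where "free_alg_ring =
    \<lparr>carrier = UNIV, mult = (*), one = 1, zero = 0, add = (+)\<rparr>"

lemma ring_free_alg_ring: "ring (free_alg_ring :: ('g, 'k::field) free_alg ring)"
proof (rule ringI)
  show "abelian_group (free_alg_ring :: ('g, 'k) free_alg ring)"
  proof (rule abelian_groupI)
    fix x :: "('g, 'k) free_alg"
    show "\<exists>y\<in>carrier free_alg_ring. y \<oplus>\<^bsub>free_alg_ring\<^esub> x = \<zero>\<^bsub>free_alg_ring\<^esub>"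
      by (rule bexI[of _ "- x"]) (simp_all add: free_alg_ring_def)
  qed (simp_all add: free_alg_ring_def add_ac)
  show "monoid (free_alg_ring :: ('g, 'k) free_alg ring)"
    by (rule monoidI) (simp_all add: free_alg_ring_def mult.assoc)
qed (simp_all add: free_alg_ring_def distrib_left distrib_right)

definition gen :: "'g \<Rightarrow> ('g, 'k::field) free_alg"
  where "gen g = Poly_Mapping.single (Word [g]) 1"

definition scalar :: "'k \<Rightarrow> ('g, 'k::field) free_alg"
  where "scalar c = Poly_Mapping.single 0 c"

text \<open>
  The right action of the free algebra determined by linear operators
  \<open>lin_ext (\<phi> g)\<close>: the leftmost letter of a word acts first.
\<close>

definition word_act ::
    "('g \<Rightarrow> 'i \<Rightarrow> ('i \<Rightarrow>\<^sub>0 'k)) \<Rightarrow> ('i \<Rightarrow>\<^sub>0 'k) \<Rightarrow> 'g word \<Rightarrow> ('i \<Rightarrow>\<^sub>0 'k::field)"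
  where "word_act \<phi> v w = fold (\<lambda>g u. lin_ext (\<phi> g) u) (letters w) v"

definition free_alg_act ::
    "('g \<Rightarrow> 'i \<Rightarrow> ('i \<Rightarrow>\<^sub>0 'k)) \<Rightarrow> ('i \<Rightarrow>\<^sub>0 'k) \<Rightarrow> ('g, 'k) free_alg \<Rightarrow> ('i \<Rightarrow>\<^sub>0 'k::field)"
  where "free_alg_act \<phi> v f = lin_ext (word_act \<phi> v) f"


section \<open>Right modules\<close>

text \<open>
  The library locale \<^locale>\<open>module\<close> requires a commutative ring. Its record is reused
  here for right modules, with \<open>a \<odot>\<^bsub>M\<^esub> x\<close> standing for the product of \<open>x\<close> by \<open>a\<close>
  on the right; note the order of the factors in the associativity axiom.
  The library predicate \<^const>\<open>submodule\<close> assumes neither commutativity nor a side.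
\<close>

locale right_module = R?: ring R + M?: abelian_group M
  for R (structure) and M (structure) +
  assumes rsmult_closed:
      "\<lbrakk>a \<in> carrier R; x \<in> carrier M\<rbrakk> \<Longrightarrow> a \<odot>\<^bsub>M\<^esub> x \<in> carrier M"
    and rsmult_distr_ring:
      "\<lbrakk>a \<in> carrier R; b \<in> carrier R; x \<in> carrier M\<rbrakk> \<Longrightarrow>
        (a \<oplus> b) \<odot>\<^bsub>M\<^esub> x = a \<odot>\<^bsub>M\<^esub> x \<oplus>\<^bsub>M\<^esub> b \<odot>\<^bsub>M\<^esub> x"
    and rsmult_distr_module:
      "\<lbrakk>a \<in> carrier R; x \<in> carrier M; y \<in> carrier M\<rbrakk> \<Longrightarrow>
        a \<odot>\<^bsub>M\<^esub> (x \<oplus>\<^bsub>M\<^esub> y) = a \<odot>\<^bsub>M\<^esub> x \<oplus>\<^bsub>M\<^esub> a \<odot>\<^bsub>M\<^esub> y"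
    and rsmult_assoc:
      "\<lbrakk>a \<in> carrier R; b \<in> carrier R; x \<in> carrier M\<rbrakk> \<Longrightarrow>
        (a \<otimes> b) \<odot>\<^bsub>M\<^esub> x = b \<odot>\<^bsub>M\<^esub> (a \<odot>\<^bsub>M\<^esub> x)"
    and rsmult_one: "x \<in> carrier M \<Longrightarrow> \<one> \<odot>\<^bsub>M\<^esub> x = x"

definition simple_right_module ::
    "('a, 'c) ring_scheme \<Rightarrow> ('a, 'b, 'd) module_scheme \<Rightarrow> bool"
  where "simple_right_module R M \<longleftrightarrow>
    right_module R M \<and> carrier M \<noteq> {\<zero>\<^bsub>M\<^esub>} \<and>
    (\<forall>N. submodule N R M \<longrightarrow> N = {\<zero>\<^bsub>M\<^esub>} \<or> N = carrier M)"


section \<open>The quantum spatial ageing algebra\<close>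

datatype ageing_gen = gE | gK | gKinv | gX | gY

definition ageing_relators :: "'k::field \<Rightarrow> (ageing_gen, 'k) free_alg set"
  where "ageing_relators q =
    {gen gK * gen gKinv - 1,
     gen gKinv * gen gK - 1,
     gen gE * gen gK - scalar (q powi (-2)) * (gen gK * gen gE),
     gen gX * gen gK - scalar (q powi (-1)) * (gen gK * gen gX),
     gen gY * gen gK - scalar q * (gen gK * gen gY),
     gen gE * gen gX - scalar q * (gen gX * gen gE),
     gen gE * gen gY - (gen gX + scalar (q powi (-1)) * (gen gY * gen gE)),
     gen gX * gen gY - scalar q * (gen gY * gen gX)}"

definition ageing_ideal :: "'k::field \<Rightarrow> (ageing_gen, 'k) free_alg set"
  where "ageing_ideal q = genideal free_alg_ring (ageing_relators q)"

definition ageing_algebra :: "'k::field \<Rightarrow> (ageing_gen, 'k) free_alg set ring"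
  where "ageing_algebra q = free_alg_ring Quot ageing_ideal q"

definition ageing_class ::
    "'k::field \<Rightarrow> (ageing_gen, 'k) free_alg \<Rightarrow> (ageing_gen, 'k) free_alg set"
  where "ageing_class q f = ageing_ideal q +>\<^bsub>free_alg_ring\<^esub> f"


section \<open>The module \<open>M\<^sub>1(\<mu>)\<close>\<close>

text \<open>
  The basis vector \<open>e(a\<^sub>1, a\<^sub>2)\<close> is \<open>basis_vec (a\<^sub>1, a\<^sub>2)\<close>. In \<open>M1_gen\<close> the predecessor
  of an index modulo \<open>n\<close> is computed as \<open>(a + n - 1) mod n\<close>. Values at indices
  outside the range of the basis play no role.
\<close>

definition basis_vec :: "'i \<Rightarrow> ('i \<Rightarrow>\<^sub>0 'k::field)"
  where "basis_vec i = Poly_Mapping.single i 1"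

definition l1_of :: "nat \<Rightarrow> nat"
  where "l1_of l = (if odd l then l else l div 2)"

fun M1_gen ::
    "'k::field \<Rightarrow> nat \<Rightarrow> 'k \<Rightarrow> 'k \<Rightarrow> 'k \<Rightarrow> 'k \<Rightarrow> ageing_gen \<Rightarrow> nat \<times> nat \<Rightarrow> (nat \<times> nat \<Rightarrow>\<^sub>0 'k)"
where
  "M1_gen q l \<mu>1 \<mu>2 \<mu>3 \<mu>4 gX (a1, a2) =
     pm_scale (\<mu>1 * q ^ (a1 + a2)) (basis_vec (a1, a2))"
| "M1_gen q l \<mu>1 \<mu>2 \<mu>3 \<mu>4 gK (a1, a2) =
     pm_scale \<mu>4 (basis_vec (a1, (a2 + 1) mod l))"
| "M1_gen q l \<mu>1 \<mu>2 \<mu>3 \<mu>4 gKinv (a1, a2) =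
     pm_scale (inverse \<mu>4) (basis_vec (a1, (a2 + l - 1) mod l))"
| "M1_gen q l \<mu>1 \<mu>2 \<mu>3 \<mu>4 gE (a1, a2) =
     pm_scale (\<mu>3 * q ^ (2 * a2))
       (if even l \<and> a1 = l div 2 - 1 then basis_vec (0, (l div 2 + a2) mod l)
        else basis_vec ((a1 + 1) mod l1_of l, a2))"
| "M1_gen q l \<mu>1 \<mu>2 \<mu>3 \<mu>4 gY (a1, a2) =
     (if even l \<and> a1 = 0
      then pm_scale (inverse \<mu>3 * q powi (- int a2) * (q * (\<mu>2 - \<mu>1) / (1 - q\<^sup>2)))
             (basis_vec (l div 2 - 1, (l div 2 + a2) mod l))
      else pm_scale (inverse \<mu>3 * q powi (- int (a1 + a2)) *
               ((q * \<mu>2 - q ^ (2 * a1 + 1) * \<mu>1) / (1 - q\<^sup>2)))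
             (basis_vec ((a1 + l1_of l - 1) mod l1_of l, a2)))"

text \<open>
  A coset acts by the common value of the actions of its representatives. Only the
  additive structure of the module is relevant; \<^const>\<open>mult\<close> and \<^const>\<open>one\<close> are junk.
\<close>

definition M1 ::
    "'k::field \<Rightarrow> nat \<Rightarrow> 'k \<Rightarrow> 'k \<Rightarrow> 'k \<Rightarrow> 'k \<Rightarrow>
      ((ageing_gen, 'k) free_alg set, nat \<times> nat \<Rightarrow>\<^sub>0 'k) module"
  where "M1 q l \<mu>1 \<mu>2 \<mu>3 \<mu>4 =
    \<lparr>carrier = {v. Poly_Mapping.keys v \<subseteq> {0..<l1_of l} \<times> {0..<l}},
     mult = undefined, one = undefined, zero = 0, add = (+),
     smult = (\<lambda>a v. the_elem (free_alg_act (M1_gen q l \<mu>1 \<mu>2 \<mu>3 \<mu>4) v ` a))\<rparr>"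

end

theory Submission
  imports Defs
begin

text \<open>
  The relators of the algebra generate a two-sided ideal of the free algebra, and the set of
  elements that act by zero on an invariant subspace is itself a two-sided ideal. Hence the
  module axioms, and the fact that cosets act by their representatives, reduce to the vanishing of
  the eight relators on the basis vectors \<open>e(a, b)\<close> (\<open>relators_act\<close>). Every generator sends a
  basis vector to a multiple of another one, and the multiples depend only on \<open>q\<^bsup>a+b\<^esup>\<close>, \<open>q\<^bsup>2a\<^esup>\<close> and
  \<open>q\<^bsup>2b\<^esup>\<close>. These three quantities change under \<open>K\<close>, \<open>E\<close> and \<open>Y\<close> by fixed powers of \<open>q\<close>, also where
  an index wraps around: passing the top of the range of \<open>a\<close> takes \<open>l\<^sub>1\<close> away from \<open>a\<close>, adds \<open>l - l\<^sub>1\<close> to \<open>b\<close>,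
  and \<open>q\<^bsup>l\<^esup> = q\<^bsup>2(l - l\<^sub>1)\<^esup> = 1\<close>. So the relations become identities of rational functions, the same
  ones for odd and for even \<open>l\<close>.

  The module is simple because \<open>X\<close> and \<open>Y E\<close> act diagonally, with the eigenvalues \<open>\<mu>\<^sub>1 q\<^bsup>a+b\<^esup>\<close> and
  \<open>(q \<mu>\<^sub>2 q\<^bsup>b-a\<^esup> - q \<mu>\<^sub>1 q\<^bsup>a+b\<^esup>) / (1 - q\<^sup>2)\<close>. As \<open>\<mu>\<^sub>1\<close> and \<open>\<mu>\<^sub>2\<close> are nonzero, both
  together determine \<open>q\<^bsup>a+b\<^esup>\<close> and \<open>q\<^bsup>2b\<^esup>\<close>, hence \<open>q\<^bsup>2a\<^esup>\<close>, hence \<open>a\<close>, because \<open>q\<^sup>2\<close> has order \<open>l\<^sub>1\<close>, and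
  then \<open>b\<close>. A nonzero submodule therefore contains a basis vector
  (\<open>basis_vec_in_invariant_subspace\<close>). The coefficients of \<open>E\<close> and \<open>K\<close> never vanish, while \<open>E\<close> runs
  cyclically through the values of \<open>a\<close> and \<open>K\<close> through those of \<open>b\<close>, so one basis vector generates
  all of them (\<open>submodule_trivial\<close>).
\<close>

section \<open>Linear maps between free vector spaces\<close>

interpretation pm: vector_space "pm_scale :: 'k::field \<Rightarrow> ('i \<Rightarrow>\<^sub>0 'k) \<Rightarrow> ('i \<Rightarrow>\<^sub>0 'k)"
  by (rule vector_space_pm_scale)

interpretation pm_pair: vector_space_pair
    "pm_scale :: 'k::field \<Rightarrow> ('i \<Rightarrow>\<^sub>0 'k) \<Rightarrow> ('i \<Rightarrow>\<^sub>0 'k)"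
    "pm_scale :: 'k::field \<Rightarrow> ('j \<Rightarrow>\<^sub>0 'k) \<Rightarrow> ('j \<Rightarrow>\<^sub>0 'k)"
  by (intro vector_space_pair.intro vector_space_pm_scale)

abbreviation pm_linear :: "(('i \<Rightarrow>\<^sub>0 'k::field) \<Rightarrow> ('j \<Rightarrow>\<^sub>0 'k)) \<Rightarrow> bool"
  where "pm_linear \<equiv> Vector_Spaces.linear pm_scale pm_scale"

lemma pm_linearI:
  assumes "\<And>u v. f (u + v) = f u + f v" and "\<And>c v. f (pm_scale c v) = pm_scale c (f v)"
  shows "pm_linear f"
  using assms by unfold_locales auto

lemma pm_linearD:
  assumes "pm_linear f"
  shows "f (u + v) = f u + f v" "f (u - v) = f u - f v" "f 0 = 0"
    "f (pm_scale c v) = pm_scale c (f v)"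
  using pm_pair.linear_add[OF assms] pm_pair.linear_diff[OF assms]
    pm_pair.linear_0[OF assms] pm_pair.linear_scale[OF assms] by blast+

lemma single_eq_pm_scale: "Poly_Mapping.single i c = pm_scale c (basis_vec i)"
  by (rule poly_mapping_eqI) (simp add: lookup_pm_scale basis_vec_def lookup_single when_def)

lemma sum_pm_scale_basis_vec:
  "(\<Sum>i\<in>Poly_Mapping.keys v. pm_scale (Poly_Mapping.lookup v i) (basis_vec i)) = v"
proof (rule poly_mapping_eqI)
  fix j
  show "Poly_Mapping.lookup (\<Sum>i\<in>Poly_Mapping.keys v.
      pm_scale (Poly_Mapping.lookup v i) (basis_vec i)) j = Poly_Mapping.lookup v j"
    by (simp add: lookup_sum lookup_pm_scale basis_vec_def lookup_single when_def in_keys_iff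
        if_distrib sum.delta cong: if_cong)
qed

lemma pm_scale_basis_vec_induct [case_names zero add]:
  fixes v :: "'i \<Rightarrow>\<^sub>0 'k::field"
  assumes "P 0" and "\<And>u i c. P u \<Longrightarrow> P (u + pm_scale c (basis_vec i))"
  shows "P v"
proof -
  have "P (\<Sum>i\<in>S. pm_scale (Poly_Mapping.lookup v i) (basis_vec i))" if "finite S" for S
    using that by induction (simp_all add: assms add.commute[of "pm_scale _ _"])
  from this[OF finite_keys, of v] show ?thesis
    by (simp add: sum_pm_scale_basis_vec)
qed

lemma keys_pm_scale: "Poly_Mapping.keys (pm_scale c v) \<subseteq> Poly_Mapping.keys v"
  by (auto simp: in_keys_iff lookup_pm_scale)

lemma subspace_keys_subset: "pm.subspace {v. Poly_Mapping.keys v \<subseteq> B}"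
  by (rule pm.subspaceI)
    (auto dest: subsetD[OF keys_add] subsetD[OF keys_pm_scale])

lemma span_basis_vec:
  "pm.span (basis_vec ` B) = {v :: 'i \<Rightarrow>\<^sub>0 'k::field. Poly_Mapping.keys v \<subseteq> B}"
proof
  show "pm.span (basis_vec ` B) \<subseteq> {v :: 'i \<Rightarrow>\<^sub>0 'k. Poly_Mapping.keys v \<subseteq> B}"
    by (rule pm.span_minimal[OF _ subspace_keys_subset]) (auto simp: basis_vec_def)
  show "{v :: 'i \<Rightarrow>\<^sub>0 'k. Poly_Mapping.keys v \<subseteq> B} \<subseteq> pm.span (basis_vec ` B)"
  proof
    fix v :: "'i \<Rightarrow>\<^sub>0 'k" assume "v \<in> {v. Poly_Mapping.keys v \<subseteq> B}"
    then have "(\<Sum>i\<in>Poly_Mapping.keys v. pm_scale (Poly_Mapping.lookup v i) (basis_vec i))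
        \<in> pm.span (basis_vec ` B)"
      by (intro pm.span_sum pm.span_scale pm.span_base imageI) blast
    then show "v \<in> pm.span (basis_vec ` B)"
      by (simp add: sum_pm_scale_basis_vec)
  qed
qed

lemma pm_linear_eq_on_basis:
  assumes "pm_linear f" "pm_linear g" "\<And>i. i \<in> B \<Longrightarrow> f (basis_vec i) = g (basis_vec i)"
    and "Poly_Mapping.keys v \<subseteq> B"
  shows "f v = g v"
  using pm_pair.linear_eq_on[OF assms(1,2), of v "basis_vec ` B"] assms(3,4)
  by (auto simp: span_basis_vec)

lemma inj_basis_vec: "inj (basis_vec :: 'i \<Rightarrow> ('i \<Rightarrow>\<^sub>0 'k::field))"
proof (rule injI)
  fix i j :: 'i assume "(basis_vec i :: 'i \<Rightarrow>\<^sub>0 'k) = basis_vec j"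
  then have "Poly_Mapping.keys (basis_vec i :: 'i \<Rightarrow>\<^sub>0 'k) = Poly_Mapping.keys (basis_vec j :: 'i \<Rightarrow>\<^sub>0 'k)"
    by simp
  then show "i = j" by (simp add: basis_vec_def)
qed

lemma independent_basis_vec:
  "pm.independent (basis_vec ` B :: ('i \<Rightarrow>\<^sub>0 'k::field) set)"
proof
  assume "pm.dependent (basis_vec ` B :: ('i \<Rightarrow>\<^sub>0 'k) set)"
  then obtain i where i: "i \<in> B"
    "(basis_vec i :: 'i \<Rightarrow>\<^sub>0 'k) \<in> pm.span (basis_vec ` B - {basis_vec i})"
    unfolding pm.dependent_def by blast
  have "basis_vec ` B - {basis_vec i} = (basis_vec ` (B - {i}) :: ('i \<Rightarrow>\<^sub>0 'k) set)"
    using inj_basis_vec by (auto dest: injD)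
  with i(2) have "(basis_vec i :: 'i \<Rightarrow>\<^sub>0 'k) \<in> {v. Poly_Mapping.keys v \<subseteq> B - {i}}"
    by (simp only: span_basis_vec)
  then show False by (auto simp: basis_vec_def)
qed

lemma dim_keys_subset:
  "pm.dim {v :: 'i \<Rightarrow>\<^sub>0 'k::field. Poly_Mapping.keys v \<subseteq> B} = card B"
proof -
  have "pm.dim {v :: 'i \<Rightarrow>\<^sub>0 'k. Poly_Mapping.keys v \<subseteq> B} =
      pm.dim (basis_vec ` B :: ('i \<Rightarrow>\<^sub>0 'k) set)"
    by (simp only: pm.dim_span flip: span_basis_vec)
  also have "\<dots> = card (basis_vec ` B :: ('i \<Rightarrow>\<^sub>0 'k) set)"
    by (rule pm.dim_eq_card_independent[OF independent_basis_vec])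
  also have "\<dots> = card B"
    by (rule card_image[OF inj_on_subset[OF inj_basis_vec subset_UNIV]])
  finally show ?thesis .
qed

text \<open>
  The sum defining \<open>lin_ext \<phi> v\<close> runs over the support of \<open>v\<close>, which varies with \<open>v\<close>; additivity
  needs one index set for several vectors.
\<close>

lemma lin_ext_superset:
  assumes "finite S" "Poly_Mapping.keys v \<subseteq> S"
  shows "lin_ext \<phi> v = (\<Sum>i\<in>S. pm_scale (Poly_Mapping.lookup v i) (\<phi> i))"
  unfolding lin_ext_def using assms
  by (intro sum.mono_neutral_left) (auto simp: in_keys_iff)

lemma pm_linear_lin_ext:
  fixes \<phi> :: "'i \<Rightarrow> ('j \<Rightarrow>\<^sub>0 'k::field)"
  shows "pm_linear (lin_ext \<phi>)"
proof (rule pm_linearI)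
  fix u v :: "'i \<Rightarrow>\<^sub>0 'k" and c
  let ?S = "Poly_Mapping.keys u \<union> Poly_Mapping.keys v"
  show "lin_ext \<phi> (u + v) = lin_ext \<phi> u + lin_ext \<phi> v"
    using keys_add[of u v]
    by (simp add: lin_ext_superset[of ?S] lookup_add pm.scale_left_distrib sum.distrib)
  show "lin_ext \<phi> (pm_scale c v) = pm_scale c (lin_ext \<phi> v)"
    using keys_pm_scale[of c v]
    by (simp add: lin_ext_superset[of "Poly_Mapping.keys v"] lookup_pm_scale pm.scale_sum_right)
qed

lemmas lin_ext_linear [simp] = pm_linearD[OF pm_linear_lin_ext]

lemma lin_ext_basis_vec [simp]: "lin_ext \<phi> (basis_vec i) = \<phi> i"
  by (simp add: lin_ext_def basis_vec_def)


section \<open>Representations of the free algebra and of its quotients\<close>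

lemma word_act_zero [simp]: "word_act \<phi> v 0 = v"
  by (simp add: word_act_def zero_word_def)

lemma word_act_single: "word_act \<phi> v (Word [g]) = lin_ext (\<phi> g) v"
  by (simp add: word_act_def)

lemma word_act_add: "word_act \<phi> v (u + w) = word_act \<phi> (word_act \<phi> v u) w"
  by (simp add: word_act_def plus_word_def)

lemma pm_linear_word_act: "pm_linear (\<lambda>v. word_act \<phi> v w)"
proof -
  have "pm_linear (\<lambda>v. fold (\<lambda>g u. lin_ext (\<phi> g) u) gs v)" for gs
  proof (induction gs)
    case Nil
    show ?case by (rule pm_linearI) simp_all
  next
    case (Cons g gs)
    then show ?case by (intro pm_linearI) (simp_all add: pm_linearD[OF Cons])
  qed
  then show ?thesis by (simp add: word_act_def)
qed

lemma pm_linear_free_alg_act_vec: "pm_linear (\<lambda>v. free_alg_act \<phi> v f)"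
  by (rule pm_linearI)
    (simp_all add: free_alg_act_def lin_ext_def pm_linearD[OF pm_linear_word_act]
      pm.scale_right_distrib sum.distrib pm.scale_sum_right mult.commute)

lemma pm_linear_free_alg_act: "pm_linear (free_alg_act \<phi> v)"
  using pm_linear_lin_ext[of "word_act \<phi> v"] by (simp add: free_alg_act_def[abs_def])

lemmas free_alg_act_linear [simp] =
  pm_linearD[OF pm_linear_free_alg_act] pm_linearD[OF pm_linear_free_alg_act_vec]

lemma free_alg_act_basis_vec: "free_alg_act \<phi> v (basis_vec w) = word_act \<phi> v w"
  by (simp add: free_alg_act_def)

lemma free_alg_act_gen [simp]: "free_alg_act \<phi> v (gen g) = lin_ext (\<phi> g) v"
  using free_alg_act_basis_vec[of \<phi> v "Word [g]"]
  by (simp add: basis_vec_def gen_def word_act_single)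

lemma free_alg_act_scalar [simp]: "free_alg_act \<phi> v (scalar c) = pm_scale c v"
  by (simp add: scalar_def single_eq_pm_scale free_alg_act_basis_vec)

lemma free_alg_act_one [simp]: "free_alg_act \<phi> v 1 = v"
  using free_alg_act_scalar[of \<phi> v 1] by (simp add: scalar_def)

text \<open>
  The product of the free algebra acts from left to right because the letters of a word do. Both
  sides are linear in \<open>f\<close> and in \<open>g\<close>, so that words suffice.
\<close>

lemma free_alg_act_mult [simp]:
  "free_alg_act \<phi> v (f * g) = free_alg_act \<phi> (free_alg_act \<phi> v f) g"
proof (induction f rule: pm_scale_basis_vec_induct)
  case (add f u c)
  have "free_alg_act \<phi> v (pm_scale c (basis_vec u) * g) =
      free_alg_act \<phi> (free_alg_act \<phi> v (pm_scale c (basis_vec u))) g"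
  proof (induction g rule: pm_scale_basis_vec_induct)
    case (add g w d)
    have "pm_scale c (basis_vec u) * pm_scale d (basis_vec w) =
        pm_scale (c * d) (basis_vec (u + w))"
      by (simp flip: single_eq_pm_scale add: mult_single)
    then show ?case
      using add by (simp add: distrib_left free_alg_act_basis_vec word_act_add
          pm_linearD[OF pm_linear_word_act] mult.commute)
  qed simp
  then show ?case using add by (simp add: distrib_right)
qed simp

text \<open>
  A coset acts by the common value of its representatives, whenever there is one.
\<close>

definition free_alg_quot_module ::
    "('g \<Rightarrow> 'i \<Rightarrow> ('i \<Rightarrow>\<^sub>0 'k)) \<Rightarrow> ('i \<Rightarrow>\<^sub>0 'k) set \<Rightarrow>
      (('g, 'k::field) free_alg set, 'i \<Rightarrow>\<^sub>0 'k) module"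
  where "free_alg_quot_module \<phi> V =
    \<lparr>carrier = V, mult = undefined, one = undefined, zero = 0, add = (+),
     smult = (\<lambda>a v. the_elem (free_alg_act \<phi> v ` a))\<rparr>"

lemma free_alg_quot_module_simps [simp]:
  "carrier (free_alg_quot_module \<phi> V) = V"
  "\<zero>\<^bsub>free_alg_quot_module \<phi> V\<^esub> = 0"
  "u \<oplus>\<^bsub>free_alg_quot_module \<phi> V\<^esub> v = u + v"
  by (simp_all add: free_alg_quot_module_def)

lemma free_alg_ring_simps [simp]:
  "carrier free_alg_ring = UNIV" "mult free_alg_ring = (*)" "one free_alg_ring = 1"
  "zero free_alg_ring = 0" "add free_alg_ring = (+)"
  by (simp_all add: free_alg_ring_def)

locale free_alg_rep =
  fixes \<phi> :: "'g \<Rightarrow> 'i \<Rightarrow> ('i \<Rightarrow>\<^sub>0 'k::field)" and V :: "('i \<Rightarrow>\<^sub>0 'k) set"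
  assumes subspace_V: "pm.subspace V"
    and lin_ext_V: "\<And>g v. v \<in> V \<Longrightarrow> lin_ext (\<phi> g) v \<in> V"
begin

lemma free_alg_act_V:
  assumes "v \<in> V"
  shows "free_alg_act \<phi> v f \<in> V"
proof (induction f rule: pm_scale_basis_vec_induct)
  case zero
  show ?case using pm.subspace_0[OF subspace_V] by simp
next
  case (add f w c)
  have "fold (\<lambda>g u. lin_ext (\<phi> g) u) gs v \<in> V" for gs
    using assms by (induction gs arbitrary: v) (simp_all add: lin_ext_V)
  then have "word_act \<phi> v w \<in> V" by (simp add: word_act_def)
  then show ?case
    using add pm.subspace_add[OF subspace_V] pm.subspace_scale[OF subspace_V]
    by (simp add: free_alg_act_basis_vec)
qed

text \<open>
  Closure under multiplication from the left uses that \<open>V\<close> is invariant: \<open>v (h f) = (v h) f\<close>.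
\<close>

lemma ideal_free_alg_annihilator:
  shows "ideal {f. \<forall>v\<in>V. free_alg_act \<phi> v f = 0} free_alg_ring"
proof (rule idealI[OF ring_free_alg_ring])
  let ?I = "{f. \<forall>v\<in>V. free_alg_act \<phi> v f = 0}"
  interpret ring "free_alg_ring :: ('g, 'k) free_alg ring" by (rule ring_free_alg_ring)
  show "subgroup ?I (add_monoid free_alg_ring)"
  proof (rule add.subgroupI)
    fix f assume f: "f \<in> ?I"
    have "\<ominus>\<^bsub>free_alg_ring\<^esub> f = 0 - f"
      by (rule minus_equality) simp_all
    with f have "\<ominus>\<^bsub>free_alg_ring\<^esub> f \<in> ?I" by (simp del: diff_0)
    then show "\<ominus>\<^bsub>free_alg_ring\<^esub> f \<in> ?I" .
  qed (auto intro: exI[of _ 0])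
qed (auto simp: free_alg_act_V)

end

locale free_alg_quot_rep = free_alg_rep \<phi> V
  for \<phi> :: "'g \<Rightarrow> 'i \<Rightarrow> ('i \<Rightarrow>\<^sub>0 'k::field)" and V :: "('i \<Rightarrow>\<^sub>0 'k) set" +
  fixes I :: "('g, 'k) free_alg set"
  assumes ideal_I: "ideal I free_alg_ring"
    and act_I: "\<And>f v. f \<in> I \<Longrightarrow> v \<in> V \<Longrightarrow> free_alg_act \<phi> v f = 0"
begin

sublocale I: ideal I free_alg_ring by (rule ideal_I)

abbreviation coset :: "('g, 'k) free_alg \<Rightarrow> ('g, 'k) free_alg set"
  where "coset f \<equiv> I +>\<^bsub>free_alg_ring\<^esub> f"

lemma smult_coset:
  assumes "v \<in> V"
  shows "coset f \<odot>\<^bsub>free_alg_quot_module \<phi> V\<^esub> v = free_alg_act \<phi> v f"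
proof -
  have "coset f = (\<lambda>h. h + f) ` I"
    by (auto simp: a_r_coset_def')
  moreover have "I \<noteq> {}" using additive_subgroup.zero_closed[OF I.is_additive_subgroup] by auto
  ultimately have "free_alg_act \<phi> v ` coset f = {free_alg_act \<phi> v f}"
    using assms by (auto simp: act_I image_image)
  then show ?thesis by (simp add: free_alg_quot_module_def)
qed

lemma carrier_Quot: "carrier (free_alg_ring Quot I) = range coset"
  by (auto simp: FactRing_def A_RCOSETS_def')

lemma add_Quot: "coset f \<oplus>\<^bsub>free_alg_ring Quot I\<^esub> coset g = coset (f + g)"
  using I.a_rcos_sum[of f g] by (simp add: FactRing_def)

lemma mult_Quot: "coset f \<otimes>\<^bsub>free_alg_ring Quot I\<^esub> coset g = coset (f * g)"
  using I.rcoset_mult_add[of f g] by (simp add: FactRing_def)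

lemma one_Quot: "\<one>\<^bsub>free_alg_ring Quot I\<^esub> = coset 1"
  by (simp add: FactRing_def)

lemma right_module_Quot: "right_module (free_alg_ring Quot I) (free_alg_quot_module \<phi> V)"
proof -
  have "abelian_group (free_alg_quot_module \<phi> V)"
  proof (rule abelian_groupI)
    fix v assume "v \<in> carrier (free_alg_quot_module \<phi> V)"
    then show "\<exists>u\<in>carrier (free_alg_quot_module \<phi> V).
        u \<oplus>\<^bsub>free_alg_quot_module \<phi> V\<^esub> v = \<zero>\<^bsub>free_alg_quot_module \<phi> V\<^esub>"
      using pm.subspace_neg[OF subspace_V] by (intro bexI[of _ "- v"]) simp_all
  qed (use pm.subspace_0[OF subspace_V] pm.subspace_add[OF subspace_V] in
      \<open>simp_all add: add_ac\<close>)
  then show ?thesis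
    unfolding right_module_def right_module_axioms_def carrier_Quot
    using I.quotient_is_ring smult_coset free_alg_act_V pm.subspace_add[OF subspace_V]
    by (auto simp: add_Quot mult_Quot one_Quot)
qed

text \<open>
  A submodule is only known to be an additive subgroup closed under the ring; it is a subspace because
  the scalars act through the constant elements of the free algebra.
\<close>

lemma submodule_QuotD:
  assumes "submodule N (free_alg_ring Quot I) (free_alg_quot_module \<phi> V)"
  shows "N \<subseteq> V" and "v \<in> N \<Longrightarrow> free_alg_act \<phi> v f \<in> N" and "pm.subspace N"
proof -
  interpret submodule N "free_alg_ring Quot I" "free_alg_quot_module \<phi> V" by (rule assms)
  show V: "N \<subseteq> V" using subset by simp
  show act: "free_alg_act \<phi> v f \<in> N" if "v \<in> N" for v f
  proof -
    have "coset f \<odot>\<^bsub>free_alg_quot_module \<phi> V\<^esub> v \<in> N"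
      by (rule smult_closed[OF _ that]) (simp add: carrier_Quot)
    moreover have "v \<in> V" using that V by blast
    ultimately show ?thesis by (simp only: smult_coset)
  qed
  show "pm.subspace N"
  proof (rule pm.subspaceI)
    show "0 \<in> N" using one_closed by simp
    show "u + v \<in> N" if "u \<in> N" "v \<in> N" for u v
      using m_closed[OF that] by simp
    show "pm_scale c v \<in> N" if "v \<in> N" for c v
      using act[OF that, of "scalar c"] by simp
  qed
qed

end


section \<open>Simultaneous eigenvectors and cyclic shifts\<close>

text \<open>
  If the support of a nonzero vector of \<open>N\<close> has two indices \<open>i\<close> and \<open>j\<close>, separated by the operator
  \<open>T m\<close>, then \<open>T m v - c m i v\<close> lies in \<open>N\<close>, has lost \<open>i\<close> from the support and has kept \<open>j\<close>. A vector of
  minimal support is thus a multiple of a basis vector.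
\<close>

lemma basis_vec_in_invariant_subspace:
  fixes N :: "('i \<Rightarrow>\<^sub>0 'k::field) set"
  assumes N: "pm.subspace N" "v \<in> N" "v \<noteq> 0" "Poly_Mapping.keys v \<subseteq> B"
    and linear: "\<And>m. pm_linear (T m)"
    and invariant: "\<And>m v. v \<in> N \<Longrightarrow> T m v \<in> N"
    and eigen: "\<And>m i. i \<in> B \<Longrightarrow> T m (basis_vec i) = pm_scale (c m i) (basis_vec i)"
    and separating: "\<And>i j. i \<in> B \<Longrightarrow> j \<in> B \<Longrightarrow> i \<noteq> j \<Longrightarrow> \<exists>m. c m i \<noteq> c m j"
  obtains i where "i \<in> B" "basis_vec i \<in> N"
proof -
  have "\<exists>i\<in>B. basis_vec i \<in> N"
    using N(2-4)
  proof (induction "card (Poly_Mapping.keys v)" arbitrary: v rule: less_induct)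
    case less
    obtain i where i: "i \<in> Poly_Mapping.keys v" using less.prems(2) by fastforce
    show ?case
    proof (cases "Poly_Mapping.keys v = {i}")
      case True
      let ?a = "Poly_Mapping.lookup v i"
      have "v = pm_scale ?a (basis_vec i)"
        using sum_pm_scale_basis_vec[of v] True by simp
      moreover have "?a \<noteq> 0" using i by (simp add: in_keys_iff)
      ultimately have "pm_scale (inverse ?a) v = basis_vec i"
        by (metis pm.scale_scale pm.scale_one left_inverse)
      then have "basis_vec i \<in> N"
        using pm.subspace_scale[OF N(1) less.prems(1)] by metis
      then show ?thesis using i less.prems(3) by auto
    next
      case False
      with i obtain j where j: "j \<in> Poly_Mapping.keys v" "j \<noteq> i" by auto
      with i less.prems(3) separating obtain m where m: "c m i \<noteq> c m j"
        by blast
      let ?w = "T m v - pm_scale (c m i) v"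
      have lookup_w: "Poly_Mapping.lookup ?w k = (c m k - c m i) * Poly_Mapping.lookup v k" for k
      proof -
        have "T m v = (\<Sum>x\<in>Poly_Mapping.keys v.
            T m (pm_scale (Poly_Mapping.lookup v x) (basis_vec x)))"
          by (subst (1) sum_pm_scale_basis_vec[of v, symmetric])
            (rule pm_pair.linear_sum[OF linear])
        also have "\<dots> = (\<Sum>x\<in>Poly_Mapping.keys v.
            pm_scale (Poly_Mapping.lookup v x * c m x) (basis_vec x))"
          using less.prems(3) eigen
          by (intro sum.cong) (auto simp: pm_linearD[OF linear])
        finally have "Poly_Mapping.lookup (T m v) k = c m k * Poly_Mapping.lookup v k"
          by (simp add: lookup_sum lookup_pm_scale basis_vec_def lookup_single when_def
              in_keys_iff if_distrib sum.delta cong: if_cong)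
        then show ?thesis by (simp add: lookup_minus lookup_pm_scale algebra_simps)
      qed
      have "Poly_Mapping.keys ?w \<subseteq> Poly_Mapping.keys v - {i}"
        by (auto simp: in_keys_iff lookup_w)
      then have "Poly_Mapping.keys ?w \<subset> Poly_Mapping.keys v" using i by blast
      moreover have "?w \<noteq> 0"
        using lookup_w[of j] m j by (auto simp: in_keys_iff)
      moreover have "?w \<in> N"
        using invariant less.prems(1) pm.subspace_diff[OF N(1)] pm.subspace_scale[OF N(1)]
        by blast
      ultimately show ?thesis
        using less.hyps[of ?w] less.prems(3) psubset_card_mono[of "Poly_Mapping.keys v"]
        by (meson finite_keys psubset_imp_subset subset_trans)
    qed
  qed
  then show thesis using that by blast
qed

lemma cyclic_induct:
  fixes n :: nat
  assumes "P a" "a < n" "b < n" and step: "\<And>a. a < n \<Longrightarrow> P a \<Longrightarrow> P (Suc a mod n)"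
  shows "P b"
proof -
  have "P ((a + k) mod n)" for k
  proof (induction k)
    case (Suc k)
    have "(a + k) mod n < n" using assms(2) by simp
    from step[OF this Suc] show ?case by (simp add: mod_Suc_eq)
  qed (use assms in simp)
  from this[of "n - a + b"] show ?thesis using assms by simp
qed

section \<open>The operators of the quantum spatial ageing algebra\<close>

lemma primitive_root_power_inj:
  fixes q :: "'k::field"
  assumes "primitive_root_of_unity l q" "q ^ i = q ^ j" "i < l" "j < l"
  shows "i = j"
proof -
  have *: False if "q ^ i = q ^ j" "i < j" "j < l" for i j
  proof -
    have "q \<noteq> 0" using assms(1) by (auto simp: primitive_root_of_unity_def power_0_left)
    moreover have "q ^ j = q ^ i * q ^ (j - i)" using that(2) by (simp flip: power_add)
    ultimately have "q ^ (j - i) = 1" using that(1) by simp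
    moreover have "0 < j - i" "j - i < l" using that by auto
    ultimately show False using assms(1) by (simp add: primitive_root_of_unity_def)
  qed
  show ?thesis using *[of i j] *[of j i] assms by (metis nat_neq_iff)
qed

lemma mult_order_primitive_root:
  assumes "primitive_root_of_unity l q"
  shows "mult_order q = l"
  unfolding mult_order_def
proof (rule Least_equality)
  fix k assume "0 < k \<and> q ^ k = 1"
  then show "l \<le> k" using assms by (auto simp: primitive_root_of_unity_def not_less)
qed (use assms in \<open>simp add: primitive_root_of_unity_def\<close>)

lemma primitive_root_power_mod:
  assumes "primitive_root_of_unity l q"
  shows "q ^ (k mod l) = q ^ k"
proof -
  have "q ^ (l * (k div l) + k mod l) = (q ^ l) ^ (k div l) * q ^ (k mod l)"
    by (simp only: power_add power_mult)
  also have "q ^ l = 1" using assms by (simp add: primitive_root_of_unity_def)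
  finally show ?thesis by simp
qed

text \<open>
  \<open>q\<^bsup>2k\<^esup> = 1\<close> means that \<open>l\<close> divides \<open>2 k\<close>, that is, \<open>l1_of l\<close> divides \<open>k\<close>.
\<close>

lemma primitive_root_square:
  fixes q :: "'k::field"
  assumes "primitive_root_of_unity l q"
  shows "primitive_root_of_unity (l1_of l) (q\<^sup>2)"
  unfolding primitive_root_of_unity_def
proof (intro conjI allI impI)
  have l: "0 < l" "q ^ l = 1" using assms by (auto simp: primitive_root_of_unity_def)
  then show "0 < l1_of l" by (auto simp: l1_of_def elim!: evenE)
  have "(q\<^sup>2) ^ l1_of l = q ^ (2 * l1_of l mod l)"
    by (simp add: primitive_root_power_mod[OF assms] power_mult)
  also have "2 * l1_of l mod l = 0" by (auto simp: l1_of_def)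
  finally show "(q\<^sup>2) ^ l1_of l = 1" by simp
  fix k assume k: "0 < k \<and> k < l1_of l"
  show "(q\<^sup>2) ^ k \<noteq> 1"
  proof
    assume "(q\<^sup>2) ^ k = 1"
    then have "q ^ (2 * k mod l) = q ^ 0"
      by (simp add: primitive_root_power_mod[OF assms] power_mult)
    then have "2 * k mod l = 0"
      using primitive_root_power_inj[OF assms] l(1) mod_less_divisor by blast
    then have "l dvd 2 * k" by auto
    then have "l1_of l dvd k"
      by (cases "even l") (auto simp: l1_of_def coprime_dvd_mult_right_iff)
    then show False using k dvd_imp_le[of "l1_of l" k] by simp
  qed
qed

locale ageing_M1 =
  fixes q \<mu>1 \<mu>2 \<mu>3 \<mu>4 :: "'k::field" and l :: nat
  assumes primitive: "primitive_root_of_unity l q" and l_ge: "l \<ge> 3"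
    and \<mu>_nz: "\<mu>1 \<noteq> 0" "\<mu>2 \<noteq> 0" "\<mu>3 \<noteq> 0" "\<mu>4 \<noteq> 0"
begin

abbreviation \<phi> :: "ageing_gen \<Rightarrow> nat \<times> nat \<Rightarrow> (nat \<times> nat \<Rightarrow>\<^sub>0 'k)"
  where "\<phi> \<equiv> M1_gen q l \<mu>1 \<mu>2 \<mu>3 \<mu>4"

abbreviation n :: nat
  where "n \<equiv> l1_of l"

abbreviation box :: "(nat \<times> nat) set"
  where "box \<equiv> {0..<n} \<times> {0..<l}"

text \<open>
  When the first index wraps around, the second one is increased by \<open>shift\<close>. With this convention
  \<open>n + shift = l\<close>, and the formulas for odd and even \<open>l\<close> coincide.
\<close>

definition shift :: nat
  where "shift = (if odd l then 0 else l div 2)"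

definition K_idx :: "nat \<times> nat \<Rightarrow> nat \<times> nat"
  where "K_idx = (\<lambda>(a, b). (a, (b + 1) mod l))"

definition Kinv_idx :: "nat \<times> nat \<Rightarrow> nat \<times> nat"
  where "Kinv_idx = (\<lambda>(a, b). (a, (b + (l - 1)) mod l))"

definition E_idx :: "nat \<times> nat \<Rightarrow> nat \<times> nat"
  where "E_idx = (\<lambda>(a, b). if a + 1 < n then (a + 1, b) else (0, (b + shift) mod l))"

definition Y_idx :: "nat \<times> nat \<Rightarrow> nat \<times> nat"
  where "Y_idx = (\<lambda>(a, b). if 0 < a then (a - 1, b) else (n - 1, (b + shift) mod l))"

text \<open>
  All coefficients of the action are rational expressions in \<open>qs\<close>, \<open>q2a\<close> and \<open>q2b\<close>.
\<close>

definition qs :: "nat \<times> nat \<Rightarrow> 'k"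
  where "qs = (\<lambda>(a, b). q ^ (a + b))"

definition q2a :: "nat \<times> nat \<Rightarrow> 'k"
  where "q2a = (\<lambda>(a, b). q ^ (2 * a))"

definition q2b :: "nat \<times> nat \<Rightarrow> 'k"
  where "q2b = (\<lambda>(a, b). q ^ (2 * b))"

lemma q_l: "q ^ l = 1"
  using primitive by (simp add: primitive_root_of_unity_def)

lemma q_nz: "q \<noteq> 0"
  using q_l l_ge by (auto simp: power_0_left)

lemma q_sq: "q\<^sup>2 \<noteq> 1"
  using primitive l_ge by (simp add: primitive_root_of_unity_def)

lemmas q_power_mod = primitive_root_power_mod[OF primitive]

lemma q_power_2_mod: "q ^ (2 * (k mod l)) = q ^ (2 * k)"
  by (metis q_power_mod power_mult mult.commute)

lemma n_shift: "n + shift = l" "2 \<le> n" "2 * shift mod l = 0"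
  using l_ge by (auto simp: l1_of_def shift_def elim!: evenE)

lemma q_2shift: "q ^ (2 * shift) = 1"
  using q_power_mod[of "2 * shift"] n_shift(3) by simp

lemma coeffs_nz: "qs i \<noteq> 0" "q2a i \<noteq> 0" "q2b i \<noteq> 0"
  using q_nz by (cases i; simp add: qs_def q2a_def q2b_def)+

lemma qs_square: "(qs i)\<^sup>2 = q2a i * q2b i"
  by (cases i) (simp add: qs_def q2a_def q2b_def power_add power_mult power_mult_distrib power2_eq_square)

lemma K_idx_coeffs: "qs (K_idx i) = q * qs i" "q2a (K_idx i) = q2a i" "q2b (K_idx i) = q\<^sup>2 * q2b i"
proof -
  obtain a b where i: "i = (a, b)" by force
  show "qs (K_idx i) = q * qs i" "q2a (K_idx i) = q2a i" "q2b (K_idx i) = q\<^sup>2 * q2b i"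
    using q_power_mod[of "b + 1"] q_power_2_mod[of "b + 1"]
    by (simp_all add: i K_idx_def qs_def q2a_def q2b_def power_add power2_eq_square)
qed

text \<open>
  At a wrap the total \<open>a + b\<close> changes from \<open>n - 1 + b\<close> to \<open>shift + b\<close>. The two sides still differ by one
  factor \<open>q\<close>, since \<open>q\<^bsup>n\<^esup>\<close> and \<open>q\<^bsup>shift\<^esup>\<close> are inverse to each other and the latter is \<open>1\<close> or \<open>-1\<close>.
\<close>

lemma E_idx_coeffs:
  assumes "i \<in> box"
  shows "qs (E_idx i) = q * qs i" "q2a (E_idx i) = q\<^sup>2 * q2a i" "q2b (E_idx i) = q2b i"
proof -
  obtain a b where i: "i = (a, b)" by force
  have wrap: "q ^ shift = q ^ (a + 1)" "q ^ (2 * (a + 1)) = 1" if "\<not> a + 1 < n"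
  proof -
    have a: "a + 1 = n" using that assms i by auto
    have "q ^ shift * q ^ n = 1" using n_shift(1) q_l by (auto simp flip: power_add simp: add.commute)
    moreover have "q ^ shift * q ^ shift = 1" using q_2shift by (simp flip: power_add mult_2)
    ultimately have *: "q ^ n = q ^ shift" using q_nz by (metis mult_left_cancel power_not_zero)
    then show "q ^ shift = q ^ (a + 1)" using a by metis
    then show "q ^ (2 * (a + 1)) = 1" using q_2shift by (metis power_mult mult.commute)
  qed
  show "qs (E_idx i) = q * qs i" "q2a (E_idx i) = q\<^sup>2 * q2a i" "q2b (E_idx i) = q2b i"
    using q_power_mod[of "b + shift"] q_power_2_mod[of "b + shift"] wrap q_2shift
    by (auto simp: i E_idx_def qs_def q2a_def q2b_def power_add power2_eq_square distrib_left mult_ac)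
qed

lemma idx_box:
  assumes "i \<in> box"
  shows "K_idx i \<in> box" "Kinv_idx i \<in> box" "E_idx i \<in> box" "Y_idx i \<in> box"
  using assms n_shift(2) l_ge by (auto simp: K_idx_def Kinv_idx_def E_idx_def Y_idx_def split: if_splits)

lemma mod_shift_shift: "b < l \<Longrightarrow> ((b + shift) mod l + shift) mod l = b"
  using n_shift(3) by (metis (no_types) mod_add_left_eq add.assoc mult_2 mod_add_right_eq add_0_right mod_less)

lemma mod_succ_pred:
  assumes "b < l"
  shows "((b + 1) mod l + (l - 1)) mod l = b" "((b + (l - 1)) mod l + 1) mod l = b"
proof -
  have "((b + 1) mod l + (l - 1)) mod l = (b + l) mod l"
    by (simp only: mod_add_left_eq) (use assms in simp)
  moreover have "((b + (l - 1)) mod l + 1) mod l = (b + l) mod l"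
    by (simp only: mod_add_left_eq) (use assms in simp)
  ultimately show "((b + 1) mod l + (l - 1)) mod l = b" "((b + (l - 1)) mod l + 1) mod l = b"
    using assms by simp_all
qed

lemma idx_inverse:
  assumes "i \<in> box"
  shows "K_idx (Kinv_idx i) = i" "Kinv_idx (K_idx i) = i" "E_idx (Y_idx i) = i" "Y_idx (E_idx i) = i"
proof -
  obtain a b where i: "i = (a, b)" by force
  with assms have "a < n" "b < l" by auto
  then show "K_idx (Kinv_idx i) = i" "Kinv_idx (K_idx i) = i" "E_idx (Y_idx i) = i"
    "Y_idx (E_idx i) = i"
    using n_shift(2) mod_shift_shift[of b] mod_succ_pred[of b]
    by (auto simp: i K_idx_def Kinv_idx_def E_idx_def Y_idx_def)
qed

lemma idx_commute:
  assumes "i \<in> box"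
  shows "K_idx (E_idx i) = E_idx (K_idx i)" "K_idx (Y_idx i) = Y_idx (K_idx i)"
  using assms
  by (auto simp: K_idx_def E_idx_def Y_idx_def mod_simps add_ac)

text \<open>
  \<open>Y_idx\<close> is inverse to \<open>E_idx\<close>, so its effect is the opposite one.
\<close>

lemma Y_idx_coeffs:
  assumes "i \<in> box"
  shows "qs (Y_idx i) = qs i / q" "q2a (Y_idx i) = q2a i / q\<^sup>2" "q2b (Y_idx i) = q2b i"
  using E_idx_coeffs[OF idx_box(4)[OF assms]] idx_inverse(3)[OF assms] q_nz
  by (simp_all add: field_simps)

lemma M1_gen_idx:
  assumes "i \<in> box"
  shows "\<phi> gX i = pm_scale (\<mu>1 * qs i) (basis_vec i)"
    and "\<phi> gK i = pm_scale \<mu>4 (basis_vec (K_idx i))"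
    and "\<phi> gKinv i = pm_scale (inverse \<mu>4) (basis_vec (Kinv_idx i))"
    and "\<phi> gE i = pm_scale (\<mu>3 * q2b i) (basis_vec (E_idx i))"
    and "\<phi> gY i = pm_scale (q * (\<mu>2 - q2a i * \<mu>1) / (\<mu>3 * qs i * (1 - q\<^sup>2))) (basis_vec (Y_idx i))"
proof -
  obtain a b where i: "i = (a, b)" by force
  with assms have ab: "a < n" "b < l" by auto
  have succ: "(a + 1) mod n = (if a + 1 < n then a + 1 else 0)"
    using ab by (cases "a + 1 = n") simp_all
  have prev: "(a + n - 1) mod n = (if 0 < a then a - 1 else n - 1)"
  proof (cases a)
    case (Suc a')
    with ab show ?thesis by simp
  qed (use n_shift(2) in simp)
  have coeff: "inverse \<mu>3 * q powi (- int (a + b)) * ((q * \<mu>2 - q ^ (2 * a + 1) * \<mu>1) / (1 - q\<^sup>2)) =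
      q * (\<mu>2 - q2a i * \<mu>1) / (\<mu>3 * qs i * (1 - q\<^sup>2))"
    by (simp add: i qs_def q2a_def power_int_minus divide_simps del: of_nat_add) 
      (simp add: algebra_simps)
  show "\<phi> gX i = pm_scale (\<mu>1 * qs i) (basis_vec i)"
    "\<phi> gK i = pm_scale \<mu>4 (basis_vec (K_idx i))"
    "\<phi> gKinv i = pm_scale (inverse \<mu>4) (basis_vec (Kinv_idx i))"
    using l_ge by (simp_all add: i qs_def K_idx_def Kinv_idx_def)
  show "\<phi> gE i = pm_scale (\<mu>3 * q2b i) (basis_vec (E_idx i))"
    using ab l_ge succ by (auto simp: i q2b_def E_idx_def shift_def l1_of_def add.commute)
  show "\<phi> gY i = pm_scale (q * (\<mu>2 - q2a i * \<mu>1) / (\<mu>3 * qs i * (1 - q\<^sup>2))) (basis_vec (Y_idx i))"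
    unfolding coeff[symmetric] using ab prev
    by (auto simp: i Y_idx_def shift_def l1_of_def algebra_simps)
qed

abbreviation V :: "(nat \<times> nat \<Rightarrow>\<^sub>0 'k) set"
  where "V \<equiv> {v. Poly_Mapping.keys v \<subseteq> box}"

lemma lin_ext_V:
  assumes "v \<in> V"
  shows "lin_ext (\<phi> g) v \<in> V"
proof -
  have "basis_vec i \<in> V" if "i \<in> box" for i
    using that by (simp add: basis_vec_def)
  then have "\<phi> g i \<in> V" if "i \<in> box" for i
    using that idx_box[OF that]
    by (cases g) (simp_all only: M1_gen_idx[OF that] pm.subspace_scale[OF subspace_keys_subset])
  then show ?thesis
    unfolding lin_ext_def using assms
    by (intro pm.subspace_sum pm.subspace_scale subspace_keys_subset) auto
qed

text \<open>
  On a basis vector every monomial of a relator leads to the same basis vector, so only scalars have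
  to be compared. All relations but the one for \<open>EY\<close> are immediate. In that one, the two coefficients
  of \<open>Y\<close> differ by a factor \<open>q\<^sup>2\<close> in front of \<open>\<mu>\<^sub>1\<close>, which cancels the denominator \<open>1 - q\<^sup>2\<close> and
  leaves \<open>\<mu>\<^sub>1 q\<^bsup>2a\<^esup> q\<^bsup>2b\<^esup> / q\<^bsup>a+b\<^esup>\<close>, the coefficient of \<open>X\<close>.
\<close>

lemma relators_act:
  assumes r: "r \<in> ageing_relators q" and "v \<in> V"
  shows "free_alg_act \<phi> v r = 0"
proof -
  have "free_alg_act \<phi> (basis_vec i) r = 0" if i: "i \<in> box" for i
  proof -
    note box = i idx_box[OF i]
    note simps = box M1_gen_idx idx_inverse[OF i] idx_commute[OF i]
      K_idx_coeffs E_idx_coeffs[OF i] Y_idx_coeffs[OF i]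
    have powi: "q powi (-2) = inverse (q\<^sup>2)" "q powi (-1) = inverse q"
      by (simp_all add: power_int_def power_inverse)
    have cancel3: "pm_scale c u - (pm_scale d u + pm_scale e u) = 0" if "c = d + e"
      for c d e and u :: "nat \<times> nat \<Rightarrow>\<^sub>0 'k"
      using that by (simp add: pm.scale_left_distrib)
    have nz: "1 - q\<^sup>2 \<noteq> 0" using q_sq by simp
    let ?act = "free_alg_act \<phi> (basis_vec i)"
    have "?act (gen gK * gen gKinv - 1) = 0" "?act (gen gKinv * gen gK - 1) = 0"
      by (simp_all add: simps \<mu>_nz)
    moreover have "?act (gen gE * gen gK - scalar (inverse (q\<^sup>2)) * (gen gK * gen gE)) = 0"
      "?act (gen gX * gen gK - scalar (inverse q) * (gen gK * gen gX)) = 0"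
      "?act (gen gY * gen gK - scalar q * (gen gK * gen gY)) = 0"
      "?act (gen gE * gen gX - scalar q * (gen gX * gen gE)) = 0"
      "?act (gen gX * gen gY - scalar q * (gen gY * gen gX)) = 0"
      using q_nz nz coeffs_nz[of i] \<mu>_nz by (simp_all add: simps field_simps)
    moreover have "?act (gen gE * gen gY - (gen gX + scalar (inverse q) * (gen gY * gen gE))) = 0"
    proof -
      have sq: "\<mu>1 * qs i * (qs i * (1 - q\<^sup>2)) = \<mu>1 * (q2a i * q2b i) * (1 - q\<^sup>2)"
        by (simp flip: qs_square add: power2_eq_square)
      have c: "\<mu>3 * q2b i * (q * (\<mu>2 - q\<^sup>2 * q2a i * \<mu>1) / (\<mu>3 * (q * qs i) * (1 - q\<^sup>2))) =
          \<mu>1 * qs i + inverse q * (q * (\<mu>2 - q2a i * \<mu>1) / (\<mu>3 * qs i * (1 - q\<^sup>2)) * (\<mu>3 * q2b i))"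
        using q_nz nz coeffs_nz[of i] \<mu>_nz
        by (simp add: divide_simps sq) (simp add: algebra_simps)
      show ?thesis using c by (simp add: simps cancel3)
    qed
    ultimately show ?thesis
      using r by (auto simp only: ageing_relators_def powi insert_iff empty_iff)
  qed
  then show ?thesis
    using pm_linear_eq_on_basis[of "\<lambda>v. free_alg_act \<phi> v r" "\<lambda>v. 0" box v]
      pm_linear_free_alg_act_vec assms(2)
    by (auto simp: pm_linearI)
qed

lemma eigenvalues_separate:
  assumes "i \<in> box" "j \<in> box" "qs i = qs j" "q2b i = q2b j"
  shows "i = j"
proof -
  obtain a b c d where ij: "i = (a, b)" "j = (c, d)" by force
  have "q2a i = q2a j"
    using assms(3,4) qs_square[of i] qs_square[of j] coeffs_nz(3)[of j] by simp
  then have "(q\<^sup>2) ^ a = (q\<^sup>2) ^ c" by (simp add: ij q2a_def power_mult)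
  then have "a = c"
    using primitive_root_power_inj[OF primitive_root_square[OF primitive]] assms(1,2) ij by auto
  moreover have "b = d"
    using assms(1-3) \<open>a = c\<close> q_nz
    by (auto simp: ij qs_def power_add intro!: primitive_root_power_inj[OF primitive])
  ultimately show ?thesis by (simp add: ij)
qed

sublocale free_alg_rep \<phi> V
  by unfold_locales (rule subspace_keys_subset, rule lin_ext_V)

sublocale free_alg_quot_rep \<phi> V "ageing_ideal q"
proof (intro free_alg_quot_rep.intro free_alg_quot_rep_axioms.intro)
  show "free_alg_rep \<phi> V" by (rule free_alg_rep_axioms)
  interpret F: ring "free_alg_ring :: (ageing_gen, 'k) free_alg ring" by (rule ring_free_alg_ring)
  show "ideal (ageing_ideal q) free_alg_ring"
    unfolding ageing_ideal_def by (rule F.genideal_ideal) simp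
  have "ageing_ideal q \<subseteq> {f. \<forall>v\<in>V. free_alg_act \<phi> v f = 0}"
    unfolding ageing_ideal_def
    by (rule F.genideal_minimal[OF ideal_free_alg_annihilator]) (use relators_act in blast)
  then show "free_alg_act \<phi> v f = 0" if "f \<in> ageing_ideal q" "v \<in> V" for f v
    using that by blast
qed

lemma M1_eq: "M1 q l \<mu>1 \<mu>2 \<mu>3 \<mu>4 = free_alg_quot_module \<phi> V"
  by (simp add: M1_def free_alg_quot_module_def)

lemma submodule_trivial:
  assumes N: "submodule N (ageing_algebra q) (M1 q l \<mu>1 \<mu>2 \<mu>3 \<mu>4)" and "N \<noteq> {0}"
  shows "N = V"
proof -
  note N = submodule_QuotD[OF N[unfolded ageing_algebra_def M1_eq]]
  obtain v where v: "v \<in> N" "v \<noteq> 0" using assms(2) pm.subspace_0[OF N(3)] by blast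
  (* T True is the action of X, T False that of Y E, and c m i is the eigenvalue at i. *)
  define T where "T m v = free_alg_act \<phi> v (if m then gen gX else gen gY * gen gE)" for m v
  define c where "c m i = (if m then \<mu>1 * qs i
      else q * (\<mu>2 - q2a i * \<mu>1) / (\<mu>3 * qs i * (1 - q\<^sup>2)) * (\<mu>3 * q2b i))" for m i
  obtain i where i: "i \<in> box" "basis_vec i \<in> N"
  proof (rule basis_vec_in_invariant_subspace[OF N(3) v, of box T c])
    show "Poly_Mapping.keys v \<subseteq> box" using v(1) N(1) by blast
    show "pm_linear (T m)" for m
      unfolding T_def by (rule pm_linear_free_alg_act_vec)
    show "T m v \<in> N" if "v \<in> N" for m v
      unfolding T_def by (rule N(2)[OF that])
    show "T m (basis_vec i) = pm_scale (c m i) (basis_vec i)" if "i \<in> box" for m i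
      using that by (simp add: T_def c_def M1_gen_idx idx_box idx_inverse Y_idx_coeffs)
    show "\<exists>m. c m i \<noteq> c m j" if "i \<in> box" "j \<in> box" "i \<noteq> j" for i j
    proof (rule ccontr)
      assume "\<nexists>m. c m i \<noteq> c m j"
      then have "c True i = c True j" "c False i = c False j" by auto
      then have s: "qs i = qs j" and
        "q * (\<mu>2 - q2a i * \<mu>1) / (\<mu>3 * qs i * (1 - q\<^sup>2)) * (\<mu>3 * q2b i) =
         q * (\<mu>2 - q2a j * \<mu>1) / (\<mu>3 * qs j * (1 - q\<^sup>2)) * (\<mu>3 * q2b j)"
        using \<mu>_nz by (simp_all add: c_def)
      then have "\<mu>3 * q * ((\<mu>2 - q2a i * \<mu>1) * q2b i) =
          \<mu>3 * q * ((\<mu>2 - q2a j * \<mu>1) * q2b j)"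
        using q_nz q_sq \<mu>_nz coeffs_nz(1)[of j] by (simp add: field_simps)
      then have "(\<mu>2 - q2a i * \<mu>1) * q2b i = (\<mu>2 - q2a j * \<mu>1) * q2b j"
        using q_nz \<mu>_nz by simp
      (* The terms with \<mu>1 agree as q2a * q2b is the square of qs; those with \<mu>2 are left. *)
      moreover have "q2a i * q2b i = q2a j * q2b j" using s by (simp flip: qs_square)
      ultimately have "q2b i = q2b j" using \<mu>_nz by (simp add: algebra_simps)
      with s that eigenvalues_separate show False by blast
    qed
  qed
  have step: "basis_vec j \<in> N"
    if "basis_vec i \<in> N" "\<phi> g i = pm_scale c (basis_vec j)" "c \<noteq> 0" for g i j c
  proof -
    have "pm_scale c (basis_vec j) \<in> N"
      using N(2)[OF that(1), of "gen g"] that(2) by simp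
    then have "pm_scale (inverse c) (pm_scale c (basis_vec j)) \<in> N"
      by (rule pm.subspace_scale[OF N(3)])
    then show ?thesis using that(3) by simp
  qed
  have K: "basis_vec (a, b) \<in> N" if "basis_vec (a, b') \<in> N" "a < n" "b < l" "b' < l" for a b b'
    by (rule cyclic_induct[of "\<lambda>b. basis_vec (a, b) \<in> N", OF that(1,4,3)])
      (use that step[OF _ M1_gen_idx(2)] \<mu>_nz in \<open>auto simp: K_idx_def\<close>)
  have E: "\<exists>b<l. basis_vec (a, b) \<in> N" if "a < n" for a
  proof (rule cyclic_induct[of "\<lambda>a. \<exists>b<l. basis_vec (a, b) \<in> N" "fst i" n])
    show "\<exists>b<l. basis_vec (fst i, b) \<in> N" "fst i < n" using i by auto
    fix a assume a: "a < n" "\<exists>b<l. basis_vec (a, b) \<in> N"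
    then obtain b where b: "b < l" "basis_vec (a, b) \<in> N" by blast
    then have box: "(a, b) \<in> box" using a by simp
    have "basis_vec (E_idx (a, b)) \<in> N"
      by (rule step[OF b(2) M1_gen_idx(4)[OF box]]) (use \<mu>_nz coeffs_nz in simp)
    moreover have "E_idx (a, b) \<in> box" "fst (E_idx (a, b)) = Suc a mod n"
      using idx_box[OF box] a by (auto simp: E_idx_def) (metis mod_self Suc_lessI)
    ultimately show "\<exists>b<l. basis_vec (Suc a mod n, b) \<in> N"
      by (metis atLeastLessThan_iff mem_Times_iff prod.collapse)
  qed (rule that)
  have "basis_vec ` box \<subseteq> N"
  proof (rule image_subsetI)
    fix i assume "i \<in> box"
    then obtain a b where i: "i = (a, b)" "a < n" "b < l" by auto
    with E obtain b' where "b' < l" "basis_vec (a, b') \<in> N" by blast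
    with K i show "basis_vec i \<in> N" by blast
  qed
  then have "pm.span (basis_vec ` box) \<subseteq> N" by (rule pm.span_minimal[OF _ N(3)])
  then show "N = V" using N(1) by (auto simp: span_basis_vec)
qed

end

theorem theorem4p1p1:
  fixes q \<mu>1 \<mu>2 \<mu>3 \<mu>4 :: "'k::alg_closed_field" and l l1 :: nat
  assumes "primitive_root_of_unity l q" and "l \<ge> 3"
    and "\<mu>1 \<noteq> 0" and "\<mu>2 \<noteq> 0" and "\<mu>3 \<noteq> 0" and "\<mu>4 \<noteq> 0"
    and "l1 = mult_order (q\<^sup>2)"
  shows "let A = ageing_algebra q; M = M1 q l \<mu>1 \<mu>2 \<mu>3 \<mu>4 in
    right_module A M \<and>
    (\<forall>c. \<forall>v\<in>carrier M. ageing_class q (scalar c) \<odot>\<^bsub>M\<^esub> v = pm_scale c v) \<and>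
    (\<forall>g. \<forall>a1<l1. \<forall>a2<l. ageing_class q (gen g) \<odot>\<^bsub>M\<^esub> basis_vec (a1, a2) =
       M1_gen q l \<mu>1 \<mu>2 \<mu>3 \<mu>4 g (a1, a2)) \<and>
    simple_right_module A M \<and>
    vector_space.dim pm_scale (carrier M) = l1 * l"
proof -
  interpret ageing_M1 q \<mu>1 \<mu>2 \<mu>3 \<mu>4 l
    using assms by unfold_locales
  have l1: "l1 = n"
    using assms(7) mult_order_primitive_root[OF primitive_root_square[OF primitive]] by simp
  have module: "right_module (ageing_algebra q) (M1 q l \<mu>1 \<mu>2 \<mu>3 \<mu>4)"
    unfolding ageing_algebra_def M1_eq by (rule right_module_Quot)
  have e: "basis_vec (a1, a2) \<in> V" if "a1 < n" "a2 < l" for a1 a2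
    using that by (simp add: basis_vec_def)
  have "(basis_vec (0, 0) :: nat \<times> nat \<Rightarrow>\<^sub>0 'k) \<noteq> 0"
    by (simp add: basis_vec_def flip: keys_eq_empty)
  then have "V \<noteq> {0}" using e[of 0 0] n_shift(2) l_ge by auto
  then have "simple_right_module (ageing_algebra q) (M1 q l \<mu>1 \<mu>2 \<mu>3 \<mu>4)"
    unfolding simple_right_module_def using module submodule_trivial by (auto simp: M1_eq)
  moreover have "pm.dim V = l1 * l" by (simp add: dim_keys_subset l1)
  ultimately show ?thesis
    using module e by (simp add: Let_def M1_eq ageing_class_def smult_coset l1)
qed

end
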